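(* Let $q$ be a positive integer that is not a power of $2$, let $\pi$ be a permutation of $\{0,\dots,q-1\}$, and let $F_\pi:I\to I$ be the associated rotated odometer on $I=[0,1)$. Assume that $F_\pi$ is stationary, with substitution $\chi$ on the alphabet $\mathcal A$ (with doubled middle symbol if $q$ is odd), and that Lebesgue measure $\mathrm{Leb}$ is ergodic for $F_\pi$. Let $T_\pi:I\times\mathbb Z\to I\times\mathbb Z$, $T_\pi(x,n)=(F_\pi(x),n+\psi(x))$, be its $\mathbb Z$-extension with skew-function $\psi=1$ on $[0,\tfrac12)$ and $\psi=-1$ on $[\tfrac12,1)$, and let $\boldsymbol d:=\gcd\{\psi(\chi(a)):a\in\mathcal A\}$. If $\boldsymbol d\ge 2$, then the skew-product $(I\times\mathbb Z,T_\pi,\mathrm{Leb}\otimes\nu)$, where $\nu$ is counting measure on $\mathbb Z$, is not ergodic.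
   Context: Rotated odometer. The von Neumann-Kakutani map $\mathfrak a:I\to I$, $I=[0,1)$, is $\mathfrak a(x)=x-(1-3\cdot 2^{-n})$ if $x\in[1-2^{1-n},1-2^{-n})$, $n\ge1$. For a permutation $\pi$ of $\{0,\dots,q-1\}$ put $R_\pi(x)=x+\frac{\pi(j)-j}{q}$ if $x\in[\frac jq,\frac{j+1}q)$. The rotated odometer is $F_\pi=\mathfrak a\circ R_\pi$; it preserves Lebesgue measure and is invertible except that $0$ has no preimage. Substitutions. Let $N=\min\{n\ge1:2^n\ge q\}$, $L_k=[0,2^{-kN})$ for $k\ge0$, and $L_{k,i}=[\frac{i}{q2^{kN}},\frac{i+1}{q2^{kN}})$ for $0\le i\le q-1$, so that the $L_{k,i}$ partition $L_k$. Let $F_{\pi,k}:L_k\to L_k$ be the first return map of $F_\pi$ to $L_k$ ($F_{\pi,0}=F_\pi$). It is known that for $k\ge1$ all points of $L_{k,i}$ have the same first return time $t_{k,i}$ to $L_k$ under $F_{\pi,k-1}$ and that, for $0\le j<t_{k,i}$, the set $F_{\pi,k-1}^j(L_{k,i})$ is an interval contained in a single $L_{k-1,w_j}$; define the word $\chi_k(i)=w_0w_1\cdots w_{t_{k,i}-1}$ over the alphabet $\{0,\dots,q-1\}$. This gives substitutions $\chi_k$, extended to words by concatenation. $F_\pi$ is called stationary if $\chi_k=\chi_1=:\chi$ for all $k\ge1$. Doubling the middle symbol. If $q$ is even, $\mathcal A=\{0,\dots,q-1\}$ and $\chi$ is unchanged. If $q$ is odd, let $m=(q-1)/2$; the letter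 $m$ is replaced by two letters $m^+$ (for the interval $[\frac mq,\frac12)$) and $m^-$ (for $[\frac12,\frac{m+1}q)$), giving the alphabet $\mathcal A=\{0,\dots,m-1,m^+,m^-,m+1,\dots,q-1\}$ with $q+1$ letters. The substitution, still called $\chi$, assigns to $a\in\mathcal A\setminus\{m^\pm\}$ the itinerary of $L_{1,a}$ under $F_\pi$ up to its first return to $L_1$ with respect to this refined partition of $I$, and to both $m^+$ and $m^-$ the itinerary of $L_{1,m}$ (these itineraries are well defined). Weights. For a letter $a\in\mathcal A$, $\psi(a)=+1$ if the interval of $I$ corresponding to $a$ lies in $[0,\frac12)$ and $\psi(a)=-1$ if it lies in $[\frac12,1)$. For a word, $\psi(w_1\cdots w_\ell)=\sum_{i=1}^\ell\psi(w_i)$. *)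

theory Defs
  imports "HOL-Analysis.Analysis" "HOL-Combinatorics.Permutations"
begin

section \<open>Ergodicity\<close>

text \<open>The invariant-set condition only. Invariance of the measure is a separate property,
  which holds for all the maps considered below; leaving it out makes the negation of
  \<open>ergodic M T\<close> assert the existence of a nontrivial invariant set.\<close>

definition ergodic :: "'a measure \<Rightarrow> ('a \<Rightarrow> 'a) \<Rightarrow> bool" where
  "ergodic M T \<longleftrightarrow>
     (\<forall>A \<in> sets M. T -` A \<inter> space M = A \<longrightarrow> A \<in> null_sets M \<or> space M - A \<in> null_sets M)"


section \<open>First returns and itineraries\<close>

definition return_time :: "('a \<Rightarrow> 'a) \<Rightarrow> 'a set \<Rightarrow> 'a \<Rightarrow> nat" where
  "return_time T B x = (LEAST n. 1 \<le> n \<and> (T ^^ n) x \<in> B)"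

definition first_return :: "('a \<Rightarrow> 'a) \<Rightarrow> 'a set \<Rightarrow> 'a \<Rightarrow> 'a" where
  "first_return T B x = (T ^^ return_time T B x) x"

definition common_return_time :: "('a \<Rightarrow> 'a) \<Rightarrow> 'a set \<Rightarrow> 'a set \<Rightarrow> nat" where
  "common_return_time T B J = (THE t. \<forall>x\<in>J. return_time T B x = t)"

text \<open>The itinerary of the whole set \<open>J\<close>, up to its first return to \<open>B\<close>, with respect to the
  partition \<open>P b\<close>, \<open>b \<in> S\<close>. It is meaningful if all points of \<open>J\<close> have the same return time
  and each iterate of \<open>J\<close> before the return lies in a single atom.\<close>

definition itinerary ::
    "('a \<Rightarrow> 'a) \<Rightarrow> 'b set \<Rightarrow> ('b \<Rightarrow> 'a set) \<Rightarrow> 'a set \<Rightarrow> 'a set \<Rightarrow> 'b list" where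
  "itinerary T S P B J =
     map (\<lambda>j. THE b. b \<in> S \<and> (T ^^ j) ` J \<subseteq> P b) [0..<common_return_time T B J]"


section \<open>The rotated odometer\<close>

text \<open>All maps of \<open>I = [0,1)\<close> are total functions on the reals whose values outside \<open>I\<close> are
  irrelevant.\<close>

definition vNK :: "real \<Rightarrow> real" where
  "vNK x = (let n = (THE n::nat. 1 \<le> n \<and> x \<in> {1 - 2 / 2 ^ n ..< 1 - 1 / 2 ^ n})
            in x - (1 - 3 / 2 ^ n))"

definition R_perm :: "nat \<Rightarrow> (nat \<Rightarrow> nat) \<Rightarrow> real \<Rightarrow> real" where
  "R_perm q \<pi> x = (let j = nat \<lfloor>real q * x\<rfloor> in x + (real (\<pi> j) - real j) / real q)"

definition F_rot :: "nat \<Rightarrow> (nat \<Rightarrow> nat) \<Rightarrow> real \<Rightarrow> real" where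
  "F_rot q \<pi> = vNK \<circ> R_perm q \<pi>"


section \<open>Substitutions and stationarity\<close>

definition N_exp :: "nat \<Rightarrow> nat" where
  "N_exp q = (LEAST n. 1 \<le> n \<and> q \<le> 2 ^ n)"

definition L :: "nat \<Rightarrow> nat \<Rightarrow> real set" where
  "L q k = {0 ..< 1 / 2 ^ (k * N_exp q)}"

definition L_sub :: "nat \<Rightarrow> nat \<Rightarrow> nat \<Rightarrow> real set" where
  "L_sub q k i = {real i / (real q * 2 ^ (k * N_exp q)) ..<
                  (real i + 1) / (real q * 2 ^ (k * N_exp q))}"

definition F_ind :: "nat \<Rightarrow> (nat \<Rightarrow> nat) \<Rightarrow> nat \<Rightarrow> real \<Rightarrow> real" where
  "F_ind q \<pi> k = first_return (F_rot q \<pi>) (L q k)"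

text \<open>The word \<open>\<chi>\<^sub>k(i)\<close>; only used for \<open>k \<ge> 1\<close>.\<close>

definition chi_seq :: "nat \<Rightarrow> (nat \<Rightarrow> nat) \<Rightarrow> nat \<Rightarrow> nat \<Rightarrow> nat list" where
  "chi_seq q \<pi> k i =
     itinerary (F_ind q \<pi> (k - 1)) {..<q} (L_sub q (k - 1)) (L q k) (L_sub q k i)"

definition stationary :: "nat \<Rightarrow> (nat \<Rightarrow> nat) \<Rightarrow> bool" where
  "stationary q \<pi> \<longleftrightarrow> (\<forall>k\<ge>1. \<forall>i<q. chi_seq q \<pi> k i = chi_seq q \<pi> 1 i)"


section \<open>Doubling the middle symbol\<close>

text \<open>\<open>Mid_plus\<close> and \<open>Mid_minus\<close> are the letters \<open>m\<^sup>+\<close> and \<open>m\<^sup>-\<close>, used only for odd \<open>q\<close>.\<close>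

datatype letter = Letter nat | Mid_plus | Mid_minus

definition mid :: "nat \<Rightarrow> nat" where
  "mid q = (q - 1) div 2"

definition alphabet :: "nat \<Rightarrow> letter set" where
  "alphabet q =
     (if even q then Letter ` {..<q}
      else Letter ` ({..<q} - {mid q}) \<union> {Mid_plus, Mid_minus})"

fun letter_interval :: "nat \<Rightarrow> letter \<Rightarrow> real set" where
  "letter_interval q (Letter i) = L_sub q 0 i"
| "letter_interval q Mid_plus = {real (mid q) / real q ..< 1 / 2}"
| "letter_interval q Mid_minus = {1 / 2 ..< (real (mid q) + 1) / real q}"

fun letter_index :: "nat \<Rightarrow> letter \<Rightarrow> nat" where
  "letter_index q (Letter i) = i"
| "letter_index q Mid_plus = mid q"
| "letter_index q Mid_minus = mid q"

definition chi :: "nat \<Rightarrow> (nat \<Rightarrow> nat) \<Rightarrow> letter \<Rightarrow> letter list" where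
  "chi q \<pi> a =
     (if even q then map Letter (chi_seq q \<pi> 1 (letter_index q a))
      else itinerary (F_rot q \<pi>) (alphabet q) (letter_interval q)
             (L q 1) (L_sub q 1 (letter_index q a)))"


section \<open>Weights and the skew product\<close>

text \<open>The interval of a letter of \<open>alphabet q\<close> lies either in \<open>[0,1/2)\<close> or in \<open>[1/2,1)\<close>.\<close>

definition psi_letter :: "nat \<Rightarrow> letter \<Rightarrow> int" where
  "psi_letter q a = (if letter_interval q a \<subseteq> {0 ..< 1 / 2} then 1 else -1)"

definition psi_word :: "nat \<Rightarrow> letter list \<Rightarrow> int" where
  "psi_word q w = (\<Sum>a\<leftarrow>w. psi_letter q a)"

definition d_gcd :: "nat \<Rightarrow> (nat \<Rightarrow> nat) \<Rightarrow> int" where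
  "d_gcd q \<pi> = Gcd ((\<lambda>a. psi_word q (chi q \<pi> a)) ` alphabet q)"

definition psi_skew :: "real \<Rightarrow> int" where
  "psi_skew x = (if x < 1 / 2 then 1 else -1)"

definition T_skew :: "nat \<Rightarrow> (nat \<Rightarrow> nat) \<Rightarrow> real \<times> int \<Rightarrow> real \<times> int" where
  "T_skew q \<pi> = (\<lambda>(x, n). (F_rot q \<pi> x, n + psi_skew x))"

definition Leb :: "real measure" where
  "Leb = restrict_space lborel {0 ..< 1}"

end

theory Submission
  imports Defs
begin

text \<open>Cut \<open>[0,1)\<close> into cells of length \<open>1/(q 2\<^sup>N)\<close>. The rotated odometer translates a
  cell onto a cell as long as the image is outside \<open>L\<^sub>1 = [0, 2\<^sup>-\<^sup>N)\<close>, and since it is injective, a cell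
  of \<open>L\<^sub>1\<close> cannot run into a cycle before returning. Hence the Birkhoff sum of \<open>\<psi>\<close> along a first
  return to \<open>L\<^sub>1\<close> is one of the numbers \<open>\<psi>(\<chi>(a))\<close>, which are all divisible by \<open>d\<close>. So if
  \<open>h(x)\<close> denotes the sum of \<open>\<psi>\<close> along the orbit of \<open>x\<close> until it hits \<open>L\<^sub>1\<close>, then \<open>\<psi>\<close> is
  the coboundary \<open>h - h \<circ> F\<^sub>\<pi>\<close> modulo \<open>d\<close>, and \<open>n + h(x) \<equiv> 0\<close> modulo \<open>d\<close> defines a
  nontrivial invariant set, which is a countable union of products of cells and points.\<close>

section \<open>Sums along orbits until a hitting time\<close>

text \<open>A partial function written as a relation: a point of \<open>B\<close> has sum 0, and a
  point whose orbit never meets \<open>B\<close> has no sum at all, so that no recurrence outside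
  \<open>B\<close> has to be proved.\<close>

inductive hit_sum :: "('a \<Rightarrow> 'a) \<Rightarrow> 'a set \<Rightarrow> ('a \<Rightarrow> int) \<Rightarrow> 'a \<Rightarrow> int \<Rightarrow> bool"
  for T B f where
  hit_now: "x \<in> B \<Longrightarrow> hit_sum T B f x 0"
| hit_later: "x \<notin> B \<Longrightarrow> hit_sum T B f (T x) s \<Longrightarrow> hit_sum T B f x (f x + s)"

lemma hit_sum_in: "x \<in> B \<Longrightarrow> hit_sum T B f x s \<longleftrightarrow> s = 0"
  by (auto intro: hit_now elim: hit_sum.cases)

text \<open>Off \<open>B\<close> the sum h satisfies h(x) = f(x) + h(T x), which is the coboundary
  equation for f.\<close>

lemma hit_sum_notin: "x \<notin> B \<Longrightarrow> hit_sum T B f x s \<longleftrightarrow> hit_sum T B f (T x) (s - f x)"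
  using hit_later[of x B T f "s - f x"] by (auto elim: hit_sum.cases)

lemma hit_sum_unique: "hit_sum T B f x s \<Longrightarrow> hit_sum T B f x s' \<Longrightarrow> s = s'"
proof (induction arbitrary: s' rule: hit_sum.induct)
  case (hit_now x)
  then show ?case by (simp add: hit_sum_in)
next
  case (hit_later x s)
  from hit_later.prems hit_later.hyps have "hit_sum T B f (T x) (s' - f x)"
    by (simp add: hit_sum_notin)
  then show ?case using hit_later.IH by fastforce
qed

lemma hit_sum_orbit:
  assumes "(T ^^ k) x \<in> B" "\<And>j. j < k \<Longrightarrow> (T ^^ j) x \<notin> B"
  shows "hit_sum T B f x (\<Sum>j<k. f ((T ^^ j) x))"
  using assms
proof (induction k arbitrary: x)
  case 0
  then show ?case by (simp add: hit_now)
next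
  case (Suc k)
  have "hit_sum T B f (T x) (\<Sum>j<k. f ((T ^^ j) (T x)))"
  proof (rule Suc.IH)
    show "(T ^^ k) (T x) \<in> B" using Suc.prems(1) by (simp add: funpow_swap1)
    show "(T ^^ j) (T x) \<notin> B" if "j < k" for j
      using Suc.prems(2)[of "Suc j"] that by (simp add: funpow_swap1)
  qed
  moreover have "x \<notin> B" using Suc.prems(2)[of 0] by simp
  ultimately show ?case
    by (simp add: sum.lessThan_Suc_shift funpow_swap1 hit_later del: sum.lessThan_Suc)
qed

lemma funpow_in: "T ` X \<subseteq> X \<Longrightarrow> x \<in> X \<Longrightarrow> (T ^^ n) x \<in> X"
  by (induction n) auto

section \<open>First returns and itineraries\<close>

lemma return_time_props:
  assumes "\<exists>n\<ge>1. (T ^^ n) x \<in> B"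
  shows "1 \<le> return_time T B x" "(T ^^ return_time T B x) x \<in> B"
  using LeastI_ex[OF assms] by (auto simp: return_time_def)

lemma not_before_return: "1 \<le> j \<Longrightarrow> j < return_time T B x \<Longrightarrow> (T ^^ j) x \<notin> B"
  unfolding return_time_def using not_less_Least by blast

text \<open>On \<open>B\<close> itself the sum is 0, so a whole return is visible only from
  \<open>T x\<close>: its orbit up to \<open>B\<close> is the return orbit of \<open>x\<close>
  without the starting point.\<close>

lemma hit_sum_return:
  assumes "\<exists>n\<ge>1. (T ^^ n) x \<in> B"
  shows "hit_sum T B f (T x) ((\<Sum>j<return_time T B x. f ((T ^^ j) x)) - f x)"
proof -
  obtain k where k: "return_time T B x = Suc k"
    using return_time_props(1)[OF assms] by (cases "return_time T B x") auto
  have "hit_sum T B f (T x) (\<Sum>j<k. f ((T ^^ j) (T x)))"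
  proof (rule hit_sum_orbit)
    show "(T ^^ k) (T x) \<in> B"
      using return_time_props(2)[OF assms] by (simp add: k funpow_swap1)
    show "(T ^^ j) (T x) \<notin> B" if "j < k" for j
      using not_before_return[of "Suc j" T B x] that by (simp add: k funpow_swap1)
  qed
  then show ?thesis
    by (simp add: k sum.lessThan_Suc_shift funpow_swap1 del: sum.lessThan_Suc)
qed

lemma funpow_cong_on:
  assumes "\<And>x. x \<in> X \<Longrightarrow> S x = T x" "T ` X \<subseteq> X" "x \<in> X"
  shows "(S ^^ n) x = (T ^^ n) x"
  by (induction n) (use assms funpow_in[OF assms(2,3)] in auto)

text \<open>For replacing \<open>F_ind q \<pi> 0\<close>, the first return to all of [0,1), by
  \<open>F_rot q \<pi>\<close>; the agreement of these maps is available only on [0,1).\<close>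

lemma itinerary_cong:
  assumes "\<And>x. x \<in> X \<Longrightarrow> U x = T x" "T ` X \<subseteq> X" "J \<subseteq> X"
  shows "itinerary U S P B J = itinerary T S P B J"
proof -
  have eq: "(U ^^ n) x = (T ^^ n) x" if "x \<in> J" for n x
    using funpow_cong_on[of X U T] assms that by auto
  then have "return_time U B x = return_time T B x" if "x \<in> J" for x
    using that by (simp add: return_time_def)
  then have "common_return_time U B J = common_return_time T B J"
    by (simp add: common_return_time_def)
  moreover have "(U ^^ n) ` J = (T ^^ n) ` J" for n
    using eq by auto
  ultimately show ?thesis by (simp add: itinerary_def)
qed

lemma first_return_whole_space:
  assumes "T ` X \<subseteq> X" "x \<in> X"
  shows "first_return T X x = T x"
proof -
  have "return_time T X x = 1"
    unfolding return_time_def by (rule Least_equality) (use assms in auto)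
  then show ?thesis by (simp add: first_return_def)
qed

text \<open>Resolves both definite descriptions in \<open>itinerary\<close>. The common return time
  is unique because \<open>J\<close> contains \<open>x\<close>; the atom around an iterate of
  \<open>J\<close> is unique because it contains the iterate of \<open>x\<close> and atoms are
  disjoint.\<close>

lemma sum_list_itinerary:
  fixes w :: "'b \<Rightarrow> int"
  assumes ret: "\<And>y. y \<in> J \<Longrightarrow> return_time T B y = return_time T B x" and x: "x \<in> J"
    and atom: "\<And>j. j < return_time T B x \<Longrightarrow> \<exists>b\<in>S. (T ^^ j) ` J \<subseteq> P b"
    and disj: "\<And>b b' y. b \<in> S \<Longrightarrow> b' \<in> S \<Longrightarrow> y \<in> P b \<Longrightarrow> y \<in> P b' \<Longrightarrow> b = b'"
    and w: "\<And>b y. b \<in> S \<Longrightarrow> y \<in> P b \<Longrightarrow> w b = f y"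
  shows "(\<Sum>b\<leftarrow>itinerary T S P B J. w b) = (\<Sum>j<return_time T B x. f ((T ^^ j) x))"
proof -
  have "common_return_time T B J = return_time T B x"
    unfolding common_return_time_def
  proof (rule the_equality)
    show "\<forall>y\<in>J. return_time T B y = return_time T B x" using ret by blast
    show "t = return_time T B x" if "\<forall>y\<in>J. return_time T B y = t" for t
      using that x by metis
  qed
  then have "(\<Sum>b\<leftarrow>itinerary T S P B J. w b)
      = (\<Sum>j<return_time T B x. w (THE b. b \<in> S \<and> (T ^^ j) ` J \<subseteq> P b))"
    by (simp add: itinerary_def comp_def interv_sum_list_conv_sum_set_nat atLeast0LessThan)
  also have "\<dots> = (\<Sum>j<return_time T B x. f ((T ^^ j) x))"
  proof (rule sum.cong)
    fix j assume "j \<in> {..<return_time T B x}"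
    then have "j < return_time T B x" by simp
    from atom[OF this] obtain b where b: "b \<in> S" "(T ^^ j) ` J \<subseteq> P b" by blast
    have mem: "(T ^^ j) x \<in> P b'" if "(T ^^ j) ` J \<subseteq> P b'" for b'
      using that x by blast
    have "(THE b. b \<in> S \<and> (T ^^ j) ` J \<subseteq> P b) = b"
    proof (rule the_equality)
      show "b \<in> S \<and> (T ^^ j) ` J \<subseteq> P b" using b by blast
      show "b' = b" if "b' \<in> S \<and> (T ^^ j) ` J \<subseteq> P b'" for b'
        using that b by (intro disj[of b' b "(T ^^ j) x"] mem) auto
    qed
    then show "w (THE b. b \<in> S \<and> (T ^^ j) ` J \<subseteq> P b) = f ((T ^^ j) x)"
      using w[OF b(1) mem[OF b(2)]] by simp
  qed simp
  finally show ?thesis .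
qed

section \<open>The von Neumann-Kakutani map\<close>

text \<open>The level is the least n with 2^-n < 1 - y: minimality gives the left endpoint, and
  \<open>0 \<le> y\<close> excludes n = 0.\<close>

lemma dyadic_level_exists:
  fixes y :: real
  assumes "0 \<le> y" "y < 1"
  obtains n :: nat where "1 \<le> n" "y \<in> {1 - 2 / 2 ^ n ..< 1 - 1 / 2 ^ n}"
proof -
  obtain k where k: "(1/2) ^ k < 1 - y"
    using real_arch_pow_inv[of "1 - y" "1/2"] assms by auto
  define n where "n = (LEAST n. (1/2) ^ n < 1 - y)"
  have n: "(1/2) ^ n < 1 - y" unfolding n_def by (rule LeastI) (rule k)
  then have "n \<noteq> 0" using assms by (intro notI) simp
  then obtain m where m: "n = Suc m" using not0_implies_Suc by blast
  have "\<not> (1/2) ^ m < 1 - y"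
    using not_less_Least[of m "\<lambda>n. (1/2) ^ n < 1 - y"] m by (simp add: n_def)
  then show ?thesis using n m by (intro that[of n]) (auto simp: power_divide)
qed

text \<open>Higher levels lie further to the right; applied in both directions, this makes the level
  in \<open>vNK\<close> unique.\<close>

lemma dyadic_level_mono:
  fixes y :: real
  assumes "y \<in> {1 - 2 / 2 ^ n ..< 1 - 1 / 2 ^ n}" "y < 1 - 1 / 2 ^ m"
  shows "n \<le> m"
proof (rule ccontr)
  assume "\<not> n \<le> m"
  then have "(2::real) ^ Suc m \<le> 2 ^ n" by (intro power_increasing) auto
  then have "2 / 2 ^ n \<le> 1 / (2 ^ m :: real)" by (simp add: field_simps)
  then show False using assms by auto
qed

lemma vNK_eq:
  assumes "1 \<le> n" "y \<in> {1 - 2 / 2 ^ n ..< 1 - 1 / 2 ^ n}"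
  shows "vNK y = y - (1 - 3 / 2 ^ n)"
proof -
  have "(THE n::nat. 1 \<le> n \<and> y \<in> {1 - 2 / 2 ^ n ..< 1 - 1 / 2 ^ n}) = n"
  proof (rule the_equality)
    show "1 \<le> n \<and> y \<in> {1 - 2 / 2 ^ n ..< 1 - 1 / 2 ^ n}" using assms by blast
    fix m :: nat assume "1 \<le> m \<and> y \<in> {1 - 2 / 2 ^ m ..< 1 - 1 / 2 ^ m}"
    then show "m = n"
      using dyadic_level_mono[of y m n] dyadic_level_mono[of y n m] assms by auto
  qed
  then show ?thesis by (simp add: vNK_def)
qed

text \<open>The image intervals [2^-n, 2^(1-n)) are recorded because they are pairwise disjoint and
  shrink to 0: they yield the range, the injectivity, and which levels land in
  \<open>L q 1\<close>.\<close>

lemma vNK_level: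
  assumes "0 \<le> y" "y < 1"
  obtains n where "1 \<le> n" "y \<in> {1 - 2 / 2 ^ n ..< 1 - 1 / 2 ^ n}"
    "vNK y = y - (1 - 3 / 2 ^ n)" "vNK y \<in> {1 / 2 ^ n ..< 2 / 2 ^ n}"
proof -
  obtain n where n: "1 \<le> n" "y \<in> {1 - 2 / 2 ^ n ..< 1 - 1 / 2 ^ n}"
    using dyadic_level_exists[OF assms] .
  then have "vNK y = y - (1 - 3 / 2 ^ n)" by (rule vNK_eq)
  with n show ?thesis by (intro that[of n]) auto
qed

lemma vNK_in: "vNK ` {0..<1} \<subseteq> {0..<1}"
proof
  fix z assume "z \<in> vNK ` {0..<1}"
  then obtain y where y: "0 \<le> y" "y < 1" "z = vNK y" by auto
  obtain n where n: "1 \<le> n" "vNK y \<in> {1 / 2 ^ n ..< 2 / 2 ^ n}"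
    using vNK_level[OF y(1,2)] .
  have "(2::real) ^ 1 \<le> 2 ^ n" using n by (intro power_increasing) auto
  then have "2 / 2 ^ n \<le> (1::real)" by simp
  moreover have "0 \<le> 1 / (2::real) ^ n" by simp
  moreover have "1 / 2 ^ n \<le> z" "z < 2 / 2 ^ n" using n(2) y(3) by auto
  ultimately have "0 \<le> z" "z < 1" by linarith+
  then show "z \<in> {0..<1}" by simp
qed

lemma vNK_inj: "inj_on vNK {0..<1}"
proof (rule inj_onI)
  fix x y assume xy: "x \<in> {0..<1}" "y \<in> {0..<1}" "vNK x = vNK y"
  from xy have "0 \<le> x" "x < 1" "0 \<le> y" "y < 1" by simp_all
  obtain n where n: "vNK x = x - (1 - 3 / 2 ^ n)" "vNK x \<in> {1 / 2 ^ n ..< 2 / 2 ^ n}"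
    using vNK_level[OF \<open>0 \<le> x\<close> \<open>x < 1\<close>] .
  obtain m where m: "vNK y = y - (1 - 3 / 2 ^ m)" "vNK y \<in> {1 / 2 ^ m ..< 2 / 2 ^ m}"
    using vNK_level[OF \<open>0 \<le> y\<close> \<open>y < 1\<close>] .
  \<comment> \<open>Used in both directions: the common image lies in only one interval [2^-n,
    2^(1-n)), which determines the level and thereby the translation.\<close>
  have *: "j \<le> k" if "z \<in> {1 / 2 ^ k ..< 2 / 2 ^ k}" "z \<in> {1 / 2 ^ j ..< 2 / 2 ^ j}"
    for z :: real and j k :: nat
  proof -
    have "1 / 2 ^ k \<le> z" "z < 2 / 2 ^ j" using that by simp_all
    then have "1 / 2 ^ k < (2::real) / 2 ^ j" by (rule order.strict_trans1)
    then have "(2::real) ^ j < 2 ^ Suc k" by (simp add: field_simps)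
    then have "j < Suc k" by (rule power_less_imp_less_exp[rotated]) simp
    then show ?thesis by simp
  qed
  have "vNK x \<in> {1 / 2 ^ m ..< 2 / 2 ^ m}" using m(2) xy(3) by simp
  then have "n = m" using *[OF n(2)] *[OF _ n(2)] by (intro antisym)
  then have "vNK y = y - (1 - 3 / 2 ^ n)" using m(1) by simp
  then show "x = y" using n(1) xy(3) by linarith
qed

section \<open>Cells\<close>

text \<open>A common multiple of \<open>q\<close> and \<open>2 ^ N_exp q\<close>: cells of length
  \<open>1 / grid q\<close> refine the intervals of \<open>R_perm\<close> as well as the dyadic
  intervals of length at least 2^-N, and the first \<open>q\<close> cells are the
  \<open>L_sub q 1 i\<close>.\<close>

definition grid :: "nat \<Rightarrow> nat" where
  "grid q = q * 2 ^ N_exp q"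

definition cell_index :: "nat \<Rightarrow> real \<Rightarrow> int" where
  "cell_index q x = \<lfloor>real (grid q) * x\<rfloor>"

text \<open>Makes 1/2 a multiple of the cell length, so that no cell straddles the jump of
  \<open>psi_skew\<close>.\<close>

lemma N_exp_ge_1: "1 \<le> N_exp q"
proof -
  have "q \<le> 2 ^ Suc q" using less_exp[of "Suc q"] by linarith
  then have "\<exists>n\<ge>1. q \<le> 2 ^ n" by (intro exI[of _ "Suc q"]) simp
  then show ?thesis unfolding N_exp_def by (rule LeastI2_ex) simp
qed

lemma grid_pos: "0 < q \<Longrightarrow> 0 < grid q"
  by (simp add: grid_def)

text \<open>If \<open>grid q * c\<close> is an integer, then \<open>x < c\<close> only depends on
  the floor of \<open>grid q * x\<close>. Constancy on cells is derived from this, with c = 1/2,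
  2^-N, k/q or an endpoint of a level of \<open>vNK\<close>.\<close>

lemma cell_less_iff:
  assumes "0 < q" "cell_index q x = cell_index q y" "real (grid q) * c \<in> \<int>"
  shows "x < c \<longleftrightarrow> y < c"
proof -
  obtain k where k: "real (grid q) * c = of_int k" using assms(3) by (rule Ints_cases)
  have "z < c \<longleftrightarrow> cell_index q z < k" for z
  proof -
    have "z < c \<longleftrightarrow> real (grid q) * z < of_int k"
      using grid_pos[OF assms(1)] by (simp add: k[symmetric])
    then show ?thesis by (simp add: cell_index_def floor_less_iff)
  qed
  then show ?thesis using assms(2) by simp
qed

lemma grid_dyadic_Ints: "n \<le> N_exp q \<Longrightarrow> real (grid q) * (1 / 2 ^ n) \<in> \<int>"
proof -
  assume "n \<le> N_exp q"
  then have "real (grid q) * (1 / 2 ^ n) = of_int (int q * 2 ^ (N_exp q - n))"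
    by (simp add: grid_def field_simps power_add[symmetric])
  then show ?thesis by (simp only: Ints_of_int)
qed

lemma grid_fraction_Ints: "0 < q \<Longrightarrow> real (grid q) * (of_int k / real q) \<in> \<int>"
proof -
  assume "0 < q"
  then have "real (grid q) * (of_int k / real q) = of_int (k * 2 ^ N_exp q)"
    by (simp add: grid_def)
  then show ?thesis by (simp only: Ints_of_int)
qed

lemma cell_half_iff:
  "0 < q \<Longrightarrow> cell_index q x = cell_index q y \<Longrightarrow> x < 1/2 \<longleftrightarrow> y < 1/2"
  using cell_less_iff[of q x y "1/2"] grid_dyadic_Ints[of 1 q] N_exp_ge_1[of q] by simp

lemma psi_skew_cell:
  "0 < q \<Longrightarrow> cell_index q x = cell_index q y \<Longrightarrow> psi_skew x = psi_skew y"
  using cell_half_iff[of q x y] by (simp add: psi_skew_def)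

section \<open>The return set and the partition intervals in terms of cells\<close>

lemma L_0: "L q 0 = {0..<1}"
  by (simp add: L_def)

lemma L_1: "L q 1 = {0 ..< 1 / 2 ^ N_exp q}"
  by (simp add: L_def)

lemma L_1_subset: "L q 1 \<subseteq> {0..<1}"
proof -
  have "1 / 2 ^ N_exp q \<le> (1::real)" by simp
  then show ?thesis unfolding L_1 by auto
qed

lemma L_1_cell:
  assumes "0 < q" "cell_index q x = cell_index q y" "0 \<le> x" "0 \<le> y"
  shows "x \<in> L q 1 \<longleftrightarrow> y \<in> L q 1"
  unfolding L_1 using cell_less_iff[OF assms(1,2) grid_dyadic_Ints[OF order.refl]] assms(3,4)
  by simp

lemma L_sub_1_iff: "0 < q \<Longrightarrow> x \<in> L_sub q 1 i \<longleftrightarrow> cell_index q x = int i"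
proof -
  assume q: "0 < q"
  have "x \<in> L_sub q 1 i \<longleftrightarrow> real i \<le> real (grid q) * x \<and> real (grid q) * x < real i + 1"
    using grid_pos[OF q] by (simp add: L_sub_def grid_def field_simps)
  then show ?thesis by (simp add: cell_index_def floor_eq_iff)
qed

lemma L_sub_0_iff: "0 < q \<Longrightarrow> x \<in> L_sub q 0 i \<longleftrightarrow> \<lfloor>real q * x\<rfloor> = int i"
  by (simp add: L_sub_def floor_eq_iff field_simps)

lemma floor_q_in:
  assumes "0 < q" "x \<in> {0..<1}"
  obtains j where "j < q" "\<lfloor>real q * x\<rfloor> = int j"
proof -
  have "0 \<le> \<lfloor>real q * x\<rfloor>" using assms by simp
  moreover have "\<lfloor>real q * x\<rfloor> < int q" using assms by (simp add: floor_less_iff)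
  ultimately show ?thesis by (intro that[of "nat \<lfloor>real q * x\<rfloor>"]) linarith+
qed

lemma floor_q_cell:
  assumes "0 < q" "cell_index q x = cell_index q y"
  shows "\<lfloor>real q * x\<rfloor> = \<lfloor>real q * y\<rfloor>"
proof -
  have "\<lfloor>real q * z\<rfloor> < k \<longleftrightarrow> z < of_int k / real q" for z k
    using assms(1) by (simp add: floor_less_iff field_simps)
  then have "\<lfloor>real q * x\<rfloor> < k \<longleftrightarrow> \<lfloor>real q * y\<rfloor> < k" for k
    using cell_less_iff[OF assms grid_fraction_Ints[OF assms(1)]] by simp
  \<comment> \<open>An integer is determined by the set of integers above it.\<close>
  then show ?thesis by (meson less_irrefl linorder_neqE)
qed

lemma L_1_subset_cells:
  assumes "0 < q" "x \<in> L q 1"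
  obtains i where "i < q" "x \<in> L_sub q 1 i"
proof -
  from assms(2) have x: "0 \<le> x" "x < 1 / 2 ^ N_exp q" unfolding L_1 by simp_all
  then have nonneg: "0 \<le> cell_index q x" by (simp add: cell_index_def)
  have "real (grid q) * x < real q"
    using x(2) assms(1) by (simp add: grid_def field_simps)
  then have less: "cell_index q x < int q" by (simp add: cell_index_def floor_less_iff)
  show ?thesis
  proof (rule that)
    show "nat (cell_index q x) < q" using nonneg less by linarith
    show "x \<in> L_sub q 1 (nat (cell_index q x))"
      unfolding L_sub_1_iff[OF assms(1)] using nonneg by simp
  qed
qed

lemma L_sub_1_subset:
  assumes "0 < q" "i < q"
  shows "L_sub q 1 i \<subseteq> L q 1"
proof
  fix x assume "x \<in> L_sub q 1 i"
  then have x: "real i / real (grid q) \<le> x" "x < (real i + 1) / real (grid q)"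
    by (simp_all add: L_sub_def grid_def)
  moreover have "(real i + 1) / real (grid q) \<le> real q / real (grid q)"
    using assms by (intro divide_right_mono) auto
  moreover have "real q / real (grid q) = 1 / 2 ^ N_exp q" using assms(1) by (simp add: grid_def)
  moreover have "0 \<le> real i / real (grid q)" by simp
  ultimately have "0 \<le> x" "x < 1 / 2 ^ N_exp q" by linarith+
  then show "x \<in> L q 1" unfolding L_1 by simp
qed

section \<open>The rotated odometer on cells\<close>

text \<open>The floor of the image is included because it identifies \<open>\<pi> j\<close> and
  hence \<open>j\<close>; the range and the injectivity of \<open>R_perm\<close> are read off from
  it.\<close>

lemma R_perm_floor:
  assumes "0 < q" "\<pi> permutes {..<q}" "x \<in> {0..<1}"
  obtains j where "j < q" "\<lfloor>real q * x\<rfloor> = int j" "\<pi> j < q"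
    "R_perm q \<pi> x = x + (real (\<pi> j) - real j) / real q"
    "\<lfloor>real q * R_perm q \<pi> x\<rfloor> = int (\<pi> j)"
proof -
  obtain j where j: "j < q" "\<lfloor>real q * x\<rfloor> = int j" using floor_q_in[OF assms(1,3)] .
  have R: "R_perm q \<pi> x = x + (real (\<pi> j) - real j) / real q"
    by (simp add: R_perm_def j(2))
  then have "real q * R_perm q \<pi> x = real q * x + of_int (int (\<pi> j) - int j)"
    using assms(1) by (simp add: distrib_left)
  then have "\<lfloor>real q * R_perm q \<pi> x\<rfloor> = int (\<pi> j)"
    using j(2) by (simp only: floor_add_int[symmetric])
  moreover have "\<pi> j < q" using permutes_in_image[OF assms(2), of j] j(1) by simp
  ultimately show ?thesis using j R that by blast
qed

lemma R_perm_in: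
  assumes "0 < q" "\<pi> permutes {..<q}"
  shows "R_perm q \<pi> ` {0..<1} \<subseteq> {0..<1}"
proof
  fix z assume "z \<in> R_perm q \<pi> ` {0..<1}"
  then obtain x where x: "x \<in> {0..<1}" "z = R_perm q \<pi> x" by blast
  obtain j where j: "\<pi> j < q" "\<lfloor>real q * z\<rfloor> = int (\<pi> j)"
    using R_perm_floor[OF assms x(1)] x(2) by metis
  then have "0 \<le> real q * z" "real q * z < real (\<pi> j) + 1"
    using floor_correct[of "real q * z"] by auto
  moreover have "real (\<pi> j) + 1 \<le> real q" using j(1) by linarith
  ultimately have "real q * 0 \<le> real q * z" "real q * z < real q * 1"
    unfolding mult_zero_right mult_1_right by linarith+
  then have "0 \<le> z" "z < 1"
    using mult_left_le_imp_le[of "real q" 0 z] mult_left_less_imp_less[of "real q" z 1] assms(1)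
    by simp_all
  then show "z \<in> {0..<1}" by simp
qed

lemma R_perm_inj:
  assumes "0 < q" "\<pi> permutes {..<q}"
  shows "inj_on (R_perm q \<pi>) {0..<1}"
proof (rule inj_onI)
  fix x y assume xy: "x \<in> {0..<1}" "y \<in> {0..<1}" "R_perm q \<pi> x = R_perm q \<pi> y"
  obtain j where j: "R_perm q \<pi> x = x + (real (\<pi> j) - real j) / real q"
      "\<lfloor>real q * R_perm q \<pi> x\<rfloor> = int (\<pi> j)"
    using R_perm_floor[OF assms xy(1)] .
  obtain k where k: "R_perm q \<pi> y = y + (real (\<pi> k) - real k) / real q"
      "\<lfloor>real q * R_perm q \<pi> y\<rfloor> = int (\<pi> k)"
    using R_perm_floor[OF assms xy(2)] .
  have "\<pi> j = \<pi> k" using j(2) k(2) xy(3) by simp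
  then have "j = k" using permutes_inj[OF assms(2)] by (simp add: inj_eq)
  then have "R_perm q \<pi> y = y + (real (\<pi> j) - real j) / real q" using k(1) by simp
  then show "x = y" using j(1) xy(3) by linarith
qed

lemma F_rot_in:
  assumes "0 < q" "\<pi> permutes {..<q}"
  shows "F_rot q \<pi> ` {0..<1} \<subseteq> {0..<1}"
  using R_perm_in[OF assms] vNK_in unfolding F_rot_def image_comp[symmetric] by blast

lemma F_rot_inj:
  assumes "0 < q" "\<pi> permutes {..<q}"
  shows "inj_on (F_rot q \<pi>) {0..<1}"
  unfolding F_rot_def
  using R_perm_inj[OF assms] inj_on_subset[OF vNK_inj R_perm_in[OF assms]] by (rule comp_inj_on)

lemma cell_index_translate:
  "0 < q \<Longrightarrow> cell_index q (x + of_int m / real (grid q)) = cell_index q x + m"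
  using grid_pos[of q] by (simp add: cell_index_def distrib_left)

lemma R_perm_cell:
  assumes "0 < q" "\<pi> permutes {..<q}" "x \<in> {0..<1}" "y \<in> {0..<1}"
    and "cell_index q x = cell_index q y"
  obtains m where "R_perm q \<pi> x = x + of_int m / real (grid q)"
    "R_perm q \<pi> y = y + of_int m / real (grid q)"
proof -
  obtain j where j: "\<lfloor>real q * x\<rfloor> = int j" "R_perm q \<pi> x = x + (real (\<pi> j) - real j) / real q"
    using R_perm_floor[OF assms(1-3)] .
  obtain k where k: "\<lfloor>real q * y\<rfloor> = int k" "R_perm q \<pi> y = y + (real (\<pi> k) - real k) / real q"
    using R_perm_floor[OF assms(1,2,4)] .
  have "j = k" using floor_q_cell[OF assms(1,5)] j(1) k(1) by simp
  moreover have "(real (\<pi> j) - real j) / real q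
      = of_int ((int (\<pi> j) - int j) * 2 ^ N_exp q) / real (grid q)"
    using assms(1) by (simp add: grid_def)
  ultimately show ?thesis using j(2) k(2) by (intro that) (simp_all only:)
qed

text \<open>Levels n > N are mapped into [0, 2^-N), so an image outside \<open>L q 1\<close> forces
  n \<le> N. Then both endpoints of the level and the translation length are multiples of the cell
  length: the whole cell lies in one level and is moved by whole cells.\<close>

lemma vNK_cell:
  assumes q: "0 < q" and u: "u \<in> {0..<1}" and v: "v \<in> {0..<1}"
    and cell: "cell_index q u = cell_index q v" and notin: "vNK u \<notin> L q 1"
  obtains m where "vNK u = u + of_int m / real (grid q)" "vNK v = v + of_int m / real (grid q)"
proof -
  from u have "0 \<le> u" "u < 1" by simp_all
  obtain n where n: "1 \<le> n" "u \<in> {1 - 2 / 2 ^ n ..< 1 - 1 / 2 ^ n}"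
      "vNK u = u - (1 - 3 / 2 ^ n)" "vNK u \<in> {1 / 2 ^ n ..< 2 / 2 ^ n}"
    using vNK_level[OF \<open>0 \<le> u\<close> \<open>u < 1\<close>] .
  have "n \<le> N_exp q"
  proof (rule ccontr)
    assume "\<not> n \<le> N_exp q"
    then have "(2::real) ^ Suc (N_exp q) \<le> 2 ^ n" by (intro power_increasing) auto
    then have "2 / 2 ^ n \<le> 1 / (2 ^ N_exp q :: real)" by (simp add: field_simps)
    moreover have "0 \<le> 1 / (2::real) ^ n" by simp
    moreover have "1 / 2 ^ n \<le> vNK u" "vNK u < 2 / 2 ^ n" using n(4) by simp_all
    ultimately have "0 \<le> vNK u" "vNK u < 1 / 2 ^ N_exp q" by linarith+
    then show False using notin unfolding L_1 by simp
  qed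
  then have Z: "real (grid q) * (1 / 2 ^ n) \<in> \<int>" by (rule grid_dyadic_Ints)
  \<comment> \<open>To be used with c = 1 and c = 2 for the endpoints of the level and with c = 3
    for the translation length.\<close>
  have lin: "real (grid q) * (1 - real c / 2 ^ n) \<in> \<int>" for c
  proof -
    have "real (grid q) * (1 - real c / 2 ^ n)
        = of_int (int (grid q)) - of_int (int c) * (real (grid q) * (1 / 2 ^ n))"
      by (simp add: field_simps)
    also have "\<dots> \<in> \<int>" by (intro Ints_diff Ints_mult Z Ints_of_int)
    finally show ?thesis .
  qed
  have "v \<in> {1 - 2 / 2 ^ n ..< 1 - 1 / 2 ^ n}"
    using n(2) cell_less_iff[OF q cell lin[of 1]] cell_less_iff[OF q cell lin[of 2]] by simp
  then have v': "vNK v = v - (1 - 3 / 2 ^ n)" using vNK_eq[OF n(1)] by blast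
  obtain m where m: "real (grid q) * (1 - real 3 / 2 ^ n) = of_int m"
    using lin[of 3] by (rule Ints_cases)
  then have "1 - 3 / 2 ^ n = of_int m / real (grid q)"
    using grid_pos[OF q] by (simp add: field_simps)
  then show ?thesis using n(3) v' by (intro that[of "- m"]) simp_all
qed

lemma F_rot_cell:
  assumes q: "0 < q" and \<pi>: "\<pi> permutes {..<q}" and x: "x \<in> {0..<1}" and y: "y \<in> {0..<1}"
    and cell: "cell_index q x = cell_index q y" and notin: "F_rot q \<pi> x \<notin> L q 1"
  obtains m where "F_rot q \<pi> x = x + of_int m / real (grid q)"
    "F_rot q \<pi> y = y + of_int m / real (grid q)"
proof -
  obtain k where k: "R_perm q \<pi> x = x + of_int k / real (grid q)"
      "R_perm q \<pi> y = y + of_int k / real (grid q)"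
    using R_perm_cell[OF q \<pi> x y cell] .
  have "cell_index q (R_perm q \<pi> x) = cell_index q (R_perm q \<pi> y)"
    by (simp add: k cell_index_translate[OF q] cell)
  moreover have "R_perm q \<pi> x \<in> {0..<1}" "R_perm q \<pi> y \<in> {0..<1}"
    using R_perm_in[OF q \<pi>] x y by blast+
  moreover have "vNK (R_perm q \<pi> x) \<notin> L q 1" using notin by (simp add: F_rot_def)
  ultimately obtain m where "vNK (R_perm q \<pi> x) = R_perm q \<pi> x + of_int m / real (grid q)"
      "vNK (R_perm q \<pi> y) = R_perm q \<pi> y + of_int m / real (grid q)"
    using vNK_cell[OF q] by metis
  then show ?thesis
    by (intro that[of "k + m"]) (simp_all add: F_rot_def k add_divide_distrib)
qed

lemma F_rot_same_cell:
  assumes q: "0 < q" and \<pi>: "\<pi> permutes {..<q}" and x: "x \<in> {0..<1}" and y: "y \<in> {0..<1}"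
    and cell: "cell_index q x = cell_index q y" and notin: "F_rot q \<pi> x \<notin> L q 1"
  shows "cell_index q (F_rot q \<pi> x) = cell_index q (F_rot q \<pi> y)"
proof -
  obtain m where m: "F_rot q \<pi> x = x + of_int m / real (grid q)"
      "F_rot q \<pi> y = y + of_int m / real (grid q)"
    using F_rot_cell[OF assms] .
  show ?thesis unfolding m cell_index_translate[OF q] cell ..
qed

text \<open>A cell may be cut when it is mapped into \<open>L q 1\<close>, but membership still
  agrees: if one of the two images is outside, both lie in the same cell by
  \<open>F_rot_same_cell\<close>, so the other is outside too.\<close>

lemma F_rot_L_1_cell:
  assumes q: "0 < q" and \<pi>: "\<pi> permutes {..<q}" and x: "x \<in> {0..<1}" and y: "y \<in> {0..<1}"
    and cell: "cell_index q x = cell_index q y"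
  shows "F_rot q \<pi> x \<in> L q 1 \<longleftrightarrow> F_rot q \<pi> y \<in> L q 1"
proof -
  have "F_rot q \<pi> b \<notin> L q 1"
    if "a \<in> {0..<1}" "b \<in> {0..<1}" "cell_index q a = cell_index q b" "F_rot q \<pi> a \<notin> L q 1"
    for a b
  proof -
    have "0 \<le> F_rot q \<pi> a" "0 \<le> F_rot q \<pi> b" using F_rot_in[OF q \<pi>] that(1,2) by fastforce+
    then show ?thesis using L_1_cell[OF q F_rot_same_cell[OF q \<pi> that]] that(4) by simp
  qed
  then show ?thesis using x y cell by metis
qed

section \<open>Orbits of cells until the first return\<close>

lemma funpow_same_cell:
  assumes q: "0 < q" and \<pi>: "\<pi> permutes {..<q}" and x: "x \<in> {0..<1}" and y: "y \<in> {0..<1}"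
    and cell: "cell_index q x = cell_index q y"
    and "\<And>j. 1 \<le> j \<Longrightarrow> j \<le> n \<Longrightarrow> (F_rot q \<pi> ^^ j) x \<notin> L q 1"
  shows "cell_index q ((F_rot q \<pi> ^^ n) x) = cell_index q ((F_rot q \<pi> ^^ n) y)"
  using assms(6)
proof (induction n)
  case 0
  show ?case by (simp add: cell)
next
  case (Suc n)
  have "cell_index q ((F_rot q \<pi> ^^ n) x) = cell_index q ((F_rot q \<pi> ^^ n) y)"
    by (rule Suc.IH) (use Suc.prems in simp)
  moreover have "F_rot q \<pi> ((F_rot q \<pi> ^^ n) x) \<notin> L q 1" using Suc.prems[of "Suc n"] by simp
  ultimately have "cell_index q (F_rot q \<pi> ((F_rot q \<pi> ^^ n) x))
      = cell_index q (F_rot q \<pi> ((F_rot q \<pi> ^^ n) y))"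
    by (rule F_rot_same_cell[OF q \<pi> funpow_in[OF F_rot_in[OF q \<pi>] x]
          funpow_in[OF F_rot_in[OF q \<pi>] y]])
  then show ?case by simp
qed

text \<open>The iterates up to n - 1 share a cell. The n-th may already be in \<open>L q 1\<close>,
  where only \<open>F_rot_L_1_cell\<close> applies; hence the strict bound on j.\<close>

lemma returns_iff:
  assumes q: "0 < q" and \<pi>: "\<pi> permutes {..<q}" and x: "x \<in> {0..<1}" and y: "y \<in> {0..<1}"
    and cell: "cell_index q x = cell_index q y"
    and "\<And>j. 1 \<le> j \<Longrightarrow> j < n \<Longrightarrow> (F_rot q \<pi> ^^ j) x \<notin> L q 1" and "1 \<le> n"
  shows "(F_rot q \<pi> ^^ n) x \<in> L q 1 \<longleftrightarrow> (F_rot q \<pi> ^^ n) y \<in> L q 1"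
proof -
  obtain k where k: "n = Suc k" using \<open>1 \<le> n\<close> by (cases n) auto
  have "cell_index q ((F_rot q \<pi> ^^ k) x) = cell_index q ((F_rot q \<pi> ^^ k) y)"
    by (rule funpow_same_cell[OF q \<pi> x y cell]) (use assms(6) k in simp)
  then have "F_rot q \<pi> ((F_rot q \<pi> ^^ k) x) \<in> L q 1 \<longleftrightarrow> F_rot q \<pi> ((F_rot q \<pi> ^^ k) y) \<in> L q 1"
    by (rule F_rot_L_1_cell[OF q \<pi> funpow_in[OF F_rot_in[OF q \<pi>] x]
          funpow_in[OF F_rot_in[OF q \<pi>] y]])
  then show ?thesis by (simp add: k)
qed

text \<open>The orbit of a grid point of \<open>L\<^sub>1\<close> stays on the grid until it returns, so otherwise it
  would close up, by injectivity at the starting point itself.\<close>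

lemma grid_point_returns:
  assumes q: "0 < q" and \<pi>: "\<pi> permutes {..<q}" and z: "z \<in> L q 1" "real (grid q) * z \<in> \<int>"
  shows "\<exists>n\<ge>1. (F_rot q \<pi> ^^ n) z \<in> L q 1"
proof (rule ccontr)
  assume "\<not> (\<exists>n\<ge>1. (F_rot q \<pi> ^^ n) z \<in> L q 1)"
  then have no: "(F_rot q \<pi> ^^ n) z \<notin> L q 1" if "1 \<le> n" for n using that by blast
  let ?G = "(\<lambda>k::int. of_int k / real (grid q)) ` {0..<int (grid q)}"
  have z01: "z \<in> {0..<1}" using z(1) L_1_subset by blast
  have in01: "(F_rot q \<pi> ^^ n) z \<in> {0..<1}" for n
    using funpow_in[OF F_rot_in[OF q \<pi>] z01] .
  have ints: "real (grid q) * (F_rot q \<pi> ^^ n) z \<in> \<int>" for n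
  proof (induction n)
    case 0
    show ?case using z(2) by simp
  next
    case (Suc n)
    have "F_rot q \<pi> ((F_rot q \<pi> ^^ n) z) \<notin> L q 1" using no[of "Suc n"] by simp
    \<comment> \<open>\<open>F_rot_cell\<close> is applied to the same point twice, just to see that
      the step is a multiple of the cell length.\<close>
    then obtain m where
      "F_rot q \<pi> ((F_rot q \<pi> ^^ n) z) = (F_rot q \<pi> ^^ n) z + of_int m / real (grid q)"
      using F_rot_cell[OF q \<pi> in01 in01 refl] by metis
    then have "real (grid q) * (F_rot q \<pi> ^^ Suc n) z
        = real (grid q) * (F_rot q \<pi> ^^ n) z + of_int m"
      using grid_pos[OF q] by (simp add: distrib_left)
    then show ?case using Suc by (simp only: Ints_add Ints_of_int)
  qed
  have "(F_rot q \<pi> ^^ n) z \<in> ?G" for n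
  proof -
    obtain k where k: "real (grid q) * (F_rot q \<pi> ^^ n) z = of_int k"
      using ints[of n] by (rule Ints_cases)
    let ?w = "(F_rot q \<pi> ^^ n) z"
    have "0 \<le> ?w" "?w < 1" using in01[of n] by simp_all
    then have "0 \<le> real (grid q) * ?w" "real (grid q) * ?w < real (grid q) * 1"
      using grid_pos[OF q] by (simp, intro mult_strict_left_mono) simp_all
    then have "(0::real) \<le> of_int k" "(of_int k :: real) < of_int (int (grid q))"
      unfolding k by simp_all
    then have "k \<in> {0..<int (grid q)}" unfolding of_int_less_iff of_int_0_le_iff by simp
    moreover have "?w = of_int k / real (grid q)"
      using k grid_pos[OF q] by (simp add: field_simps)
    ultimately show ?thesis by blast
  qed
  then have "range (\<lambda>n. (F_rot q \<pi> ^^ n) z) \<subseteq> ?G" by blast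
  then have "finite (range (\<lambda>n. (F_rot q \<pi> ^^ n) z))" by (rule finite_subset) simp
  then have "\<not> inj (\<lambda>n. (F_rot q \<pi> ^^ n) z)" using finite_imageD by fastforce
  then obtain i j where "i < j" and ij: "(F_rot q \<pi> ^^ i) z = (F_rot q \<pi> ^^ j) z"
    unfolding inj_on_def by (metis linorder_neqE_nat)
  have "j = i + (j - i)" using \<open>i < j\<close> by simp
  then have "(F_rot q \<pi> ^^ i) z = (F_rot q \<pi> ^^ i) ((F_rot q \<pi> ^^ (j - i)) z)"
    using ij by (metis funpow_add comp_apply)
  moreover have "inj_on (F_rot q \<pi> ^^ i) {0..<1}"
  proof (induction i)
    case (Suc i)
    have "(F_rot q \<pi> ^^ i) ` {0..<1} \<subseteq> {0..<1}" using funpow_in[OF F_rot_in[OF q \<pi>]] by blast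
    then have "inj_on (F_rot q \<pi>) ((F_rot q \<pi> ^^ i) ` {0..<1})"
      by (rule inj_on_subset[OF F_rot_inj[OF q \<pi>]])
    then show ?case using comp_inj_on[OF Suc] by (simp only: funpow.simps)
  qed simp
  ultimately have "z = (F_rot q \<pi> ^^ (j - i)) z" using z01 in01 by (meson inj_onD)
  then show False using no[of "j - i"] z(1) \<open>i < j\<close> by simp
qed

text \<open>The left endpoint of the cell of \<open>x\<close> is a grid point and therefore returns;
  \<open>returns_iff\<close> carries its return time over to \<open>x\<close>.\<close>

lemma L_1_returns:
  assumes q: "0 < q" and \<pi>: "\<pi> permutes {..<q}" and x: "x \<in> L q 1"
  shows "\<exists>n\<ge>1. (F_rot q \<pi> ^^ n) x \<in> L q 1"
proof -
  obtain i where i: "i < q" "x \<in> L_sub q 1 i" using L_1_subset_cells[OF q x] .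
  define z where "z = real i / real (grid q)"
  have gz: "real (grid q) * z = of_int (int i)" using grid_pos[OF q] by (simp add: z_def)
  then have cell: "cell_index q z = int i" unfolding cell_index_def by simp
  then have zL: "z \<in> L q 1" using L_sub_1_iff[OF q] L_sub_1_subset[OF q i(1)] by blast
  have ex: "\<exists>n. 1 \<le> n \<and> (F_rot q \<pi> ^^ n) z \<in> L q 1"
    using grid_point_returns[OF q \<pi> zL] gz by (simp only: Ints_of_int)
  define t where "t = return_time (F_rot q \<pi>) (L q 1) z"
  have t: "1 \<le> t" "(F_rot q \<pi> ^^ t) z \<in> L q 1"
    unfolding t_def by (rule return_time_props[OF ex])+
  have "(F_rot q \<pi> ^^ t) z \<in> L q 1 \<longleftrightarrow> (F_rot q \<pi> ^^ t) x \<in> L q 1"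
  proof (rule returns_iff[OF q \<pi>])
    show "z \<in> {0..<1}" "x \<in> {0..<1}" using zL x L_1_subset by blast+
    show "cell_index q z = cell_index q x" using cell i(2) L_sub_1_iff[OF q] by simp
    show "(F_rot q \<pi> ^^ j) z \<notin> L q 1" if "1 \<le> j" "j < t" for j
      using not_before_return that unfolding t_def .
  qed (rule t(1))
  then show ?thesis using t by blast
qed

text \<open>By \<open>returns_iff\<close> the first return time of either point is a return time of
  the other, so each bounds the other from above.\<close>

lemma return_time_cell:
  assumes q: "0 < q" and \<pi>: "\<pi> permutes {..<q}" and x: "x \<in> L q 1" and y: "y \<in> L q 1"
    and cell: "cell_index q x = cell_index q y"
  shows "return_time (F_rot q \<pi>) (L q 1) x = return_time (F_rot q \<pi>) (L q 1) y"
proof -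
  let ?r = "return_time (F_rot q \<pi>) (L q 1)"
  have "?r b \<le> ?r a"
    if ab: "a \<in> L q 1" "b \<in> L q 1" "cell_index q a = cell_index q b" for a b
  proof -
    have r: "1 \<le> ?r a" "(F_rot q \<pi> ^^ ?r a) a \<in> L q 1"
      by (rule return_time_props[OF L_1_returns[OF q \<pi> ab(1)]])+
    have "(F_rot q \<pi> ^^ ?r a) a \<in> L q 1 \<longleftrightarrow> (F_rot q \<pi> ^^ ?r a) b \<in> L q 1"
    proof (rule returns_iff[OF q \<pi> _ _ ab(3)])
      show "a \<in> {0..<1}" "b \<in> {0..<1}" using ab L_1_subset by blast+
      show "(F_rot q \<pi> ^^ j) a \<notin> L q 1" if "1 \<le> j" "j < ?r a" for j
        using not_before_return that .
    qed (rule r(1))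
    then have "1 \<le> ?r a \<and> (F_rot q \<pi> ^^ ?r a) b \<in> L q 1" using r by blast
    then show ?thesis unfolding return_time_def[of _ _ b] by (rule Least_le)
  qed
  from this[OF x y cell] this[OF y x cell[symmetric]] show ?thesis by (rule antisym[rotated])
qed

section \<open>Weights of the itineraries\<close>

text \<open>Stated in the form of the hypothesis \<open>cells\<close> of
  \<open>sum_list_itinerary_F_rot\<close>: one atom contains the entire cell of
  \<open>u\<close>.\<close>

lemma L_sub_0_cell:
  assumes "0 < q" "u \<in> {0..<1}"
  shows "\<exists>i\<in>{..<q}. \<forall>v. cell_index q v = cell_index q u \<longrightarrow> v \<in> L_sub q 0 i"
proof -
  obtain i where i: "i < q" "\<lfloor>real q * u\<rfloor> = int i" using floor_q_in[OF assms] .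
  have "v \<in> L_sub q 0 i" if "cell_index q v = cell_index q u" for v
    using floor_q_cell[OF assms(1) that] i(2) L_sub_0_iff[OF assms(1)] by simp
  then show ?thesis using i(1) by blast
qed

lemma L_sub_0_unique:
  "0 < q \<Longrightarrow> y \<in> L_sub q 0 i \<Longrightarrow> y \<in> L_sub q 0 j \<Longrightarrow> i = j"
  by (simp add: L_sub_0_iff)

text \<open>For q = 2m + 1 the point 1/2 is interior to [m/q, (m+1)/q), so it cuts this interval
  into the two middle letters.\<close>

lemma mid_intervals:
  assumes "0 < q" "odd q"
  shows "y \<in> letter_interval q Mid_plus \<longleftrightarrow> y \<in> L_sub q 0 (mid q) \<and> y < 1/2"
    and "y \<in> letter_interval q Mid_minus \<longleftrightarrow> y \<in> L_sub q 0 (mid q) \<and> 1/2 \<le> y"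
proof -
  have q: "real q = 2 * real (mid q) + 1"
    using assms(2) by (elim oddE) (simp add: mid_def)
  have half: "real (mid q) / real q < 1/2" "1/2 < (real (mid q) + 1) / real q"
    unfolding q by (simp_all add: field_simps)
  show "y \<in> letter_interval q Mid_plus \<longleftrightarrow> y \<in> L_sub q 0 (mid q) \<and> y < 1/2"
    and "y \<in> letter_interval q Mid_minus \<longleftrightarrow> y \<in> L_sub q 0 (mid q) \<and> 1/2 \<le> y"
    using half unfolding letter_interval.simps L_sub_def mult_0 power_0 mult_1_right
      atLeastLessThan_iff by linarith+
qed

lemma letter_interval_subset:
  assumes "0 < q" "a \<in> alphabet q" "y \<in> letter_interval q a"
  shows "y \<in> L_sub q 0 (letter_index q a)"
proof (cases a)
  case (Letter i)
  then show ?thesis using assms by simp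
next
  case Mid_plus
  then have "odd q" using assms(2) by (auto simp: alphabet_def split: if_splits)
  then show ?thesis using mid_intervals(1)[OF assms(1)] assms(3) Mid_plus by simp
next
  case Mid_minus
  then have "odd q" using assms(2) by (auto simp: alphabet_def split: if_splits)
  then show ?thesis using mid_intervals(2)[OF assms(1)] assms(3) Mid_minus by simp
qed

lemma letter_index_less: "0 < q \<Longrightarrow> a \<in> alphabet q \<Longrightarrow> letter_index q a < q"
  by (auto simp: alphabet_def mid_def split: if_splits)

text \<open>Guarantees that the gcd over the alphabet sees the return word of every
  \<open>L_sub q 1 i\<close>. Since \<open>chi\<close> depends on a letter only through its index,
  either middle letter can represent \<open>mid q\<close>.\<close>

lemma letter_index_surj:
  assumes "i < q"
  obtains a where "a \<in> alphabet q" "letter_index q a = i"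
proof (cases "odd q \<and> i = mid q")
  case True
  then show ?thesis by (intro that[of Mid_plus]) (auto simp: alphabet_def)
next
  case False
  then show ?thesis using assms by (intro that[of "Letter i"]) (auto simp: alphabet_def)
qed

text \<open>In the middle interval the letter is chosen by the side of 1/2 on which \<open>u\<close>
  lies; its cell stays on that side because 1/2 is a grid point.\<close>

lemma letter_interval_cell:
  assumes q: "0 < q" and u: "u \<in> {0..<1}"
  shows "\<exists>a\<in>alphabet q. \<forall>v. cell_index q v = cell_index q u \<longrightarrow> v \<in> letter_interval q a"
proof -
  obtain i where i: "i < q"
      "\<And>v. cell_index q v = cell_index q u \<Longrightarrow> v \<in> L_sub q 0 i"
    using L_sub_0_cell[OF assms] by auto
  show ?thesis
  proof (cases "odd q \<and> i = mid q")
    case False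
    then have "Letter i \<in> alphabet q" using i(1) by (auto simp: alphabet_def)
    then show ?thesis using i(2) by (intro bexI[of _ "Letter i"]) simp_all
  next
    case True
    then have odd: "odd q" and mid: "i = mid q" by simp_all
    have "Mid_plus \<in> alphabet q" "Mid_minus \<in> alphabet q" using odd by (simp_all add: alphabet_def)
    moreover have "v < 1/2 \<longleftrightarrow> u < 1/2" if "cell_index q v = cell_index q u" for v
      using cell_half_iff[OF q that] .
    ultimately show ?thesis
      using i(2) mid_intervals[OF q odd] unfolding mid by (cases "u < 1/2") (metis not_less)+
  qed
qed

text \<open>A common point forces equal indices. Within one alphabet only the two middle letters
  share an index, and 1/2 separates them.\<close>

lemma letter_interval_unique:
  assumes "0 < q" "a \<in> alphabet q" "b \<in> alphabet q"
    and "y \<in> letter_interval q a" "y \<in> letter_interval q b"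
  shows "a = b"
proof -
  have idx: "letter_index q a = letter_index q b"
    using L_sub_0_unique[OF assms(1)] letter_interval_subset assms by blast
  show ?thesis
    by (cases a; cases b) (use idx assms in \<open>auto simp: alphabet_def split: if_splits\<close>)
qed

text \<open>No letter interval straddles 1/2, so the inclusion test in \<open>psi_letter\<close> is
  decided by the single point \<open>y\<close>.\<close>

lemma psi_letter_eq:
  assumes q: "0 < q" and a: "a \<in> alphabet q" and y: "y \<in> letter_interval q a"
  shows "psi_letter q a = psi_skew y"
proof -
  have "letter_interval q a \<subseteq> {0..<1/2} \<longleftrightarrow> y < 1/2"
  proof (cases a)
    case (Letter i)
    have yi: "real i / real q \<le> y" "y < (real i + 1) / real q"
      using y Letter by (simp_all add: L_sub_def)
    \<comment> \<open>Equality would make \<open>q\<close> odd and \<open>i\<close> the middle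
      index, which the alphabet replaces by two other letters.\<close>
    have "q \<noteq> 2 * i + 1" using a Letter by (auto simp: alphabet_def mid_def split: if_splits)
    then consider "2 * i + 2 \<le> q" | "q \<le> 2 * i" by linarith
    then show ?thesis
    proof cases
      case 1
      then have "(real i + 1) / real q \<le> 1/2" using q by (simp add: field_simps)
      moreover have "0 \<le> real i / real q" by simp
      ultimately have "L_sub q 0 i \<subseteq> {0..<1/2}" unfolding L_sub_def by auto
      moreover have "y < 1/2" using yi(2) \<open>(real i + 1) / real q \<le> 1/2\<close> by linarith
      ultimately show ?thesis using Letter by simp
    next
      case 2
      then have "1/2 \<le> real i / real q" using q by (simp add: field_simps)
      then have "1/2 \<le> y" using yi by linarith
      then show ?thesis using y by force
    qed
  next
    case Mid_plus
    have "0 \<le> real (mid q) / real q" by simp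
    then show ?thesis using y Mid_plus by auto
  next
    case Mid_minus
    then have "1/2 \<le> y" using y by simp
    then show ?thesis using y by force
  qed
  then show ?thesis by (simp add: psi_letter_def psi_skew_def)
qed

text \<open>General in the partition, so that it serves both the plain one (even \<open>q\<close>)
  and the one with the doubled middle symbol (odd \<open>q\<close>).\<close>

lemma sum_list_itinerary_F_rot:
  fixes w :: "'b \<Rightarrow> int"
  assumes q: "0 < q" and \<pi>: "\<pi> permutes {..<q}" and i: "i < q" and x: "x \<in> L_sub q 1 i"
    and cells: "\<And>u. u \<in> {0..<1} \<Longrightarrow> \<exists>b\<in>S. \<forall>v. cell_index q v = cell_index q u \<longrightarrow> v \<in> P b"
    and disj: "\<And>b b' y. b \<in> S \<Longrightarrow> b' \<in> S \<Longrightarrow> y \<in> P b \<Longrightarrow> y \<in> P b' \<Longrightarrow> b = b'"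
    and w: "\<And>b y. b \<in> S \<Longrightarrow> y \<in> P b \<Longrightarrow> w b = psi_skew y"
  shows "(\<Sum>b\<leftarrow>itinerary (F_rot q \<pi>) S P (L q 1) (L_sub q 1 i). w b)
    = (\<Sum>j<return_time (F_rot q \<pi>) (L q 1) x. psi_skew ((F_rot q \<pi> ^^ j) x))"
proof (rule sum_list_itinerary[OF _ x _ disj w])
  have sub: "y \<in> L q 1" "y \<in> {0..<1}" "cell_index q x = cell_index q y" if "y \<in> L_sub q 1 i" for y
  proof -
    show "y \<in> L q 1" using L_sub_1_subset[OF q i] that by blast
    then show "y \<in> {0..<1}" using L_1_subset by blast
    show "cell_index q x = cell_index q y" using that x L_sub_1_iff[OF q] by simp
  qed
  show "return_time (F_rot q \<pi>) (L q 1) y = return_time (F_rot q \<pi>) (L q 1) x"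
    if "y \<in> L_sub q 1 i" for y
    by (rule return_time_cell[OF q \<pi> sub(1)[OF that] sub(1)[OF x] sub(3)[OF that, symmetric]])
  fix j assume j: "j < return_time (F_rot q \<pi>) (L q 1) x"
  have "(F_rot q \<pi> ^^ j) x \<in> {0..<1}" using funpow_in[OF F_rot_in[OF q \<pi>] sub(2)[OF x]] .
  then obtain b where b: "b \<in> S"
      "\<And>v. cell_index q v = cell_index q ((F_rot q \<pi> ^^ j) x) \<Longrightarrow> v \<in> P b"
    using cells by meson
  have "cell_index q ((F_rot q \<pi> ^^ j) x) = cell_index q ((F_rot q \<pi> ^^ j) y)"
    if "y \<in> L_sub q 1 i" for y
  proof (rule funpow_same_cell[OF q \<pi> sub(2)[OF x] sub(2)[OF that] sub(3)[OF that]])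
    show "(F_rot q \<pi> ^^ k) x \<notin> L q 1" if "1 \<le> k" "k \<le> j" for k
      using not_before_return[OF that(1)] that(2) j by (meson le_less_trans)
  qed
  then have "(F_rot q \<pi> ^^ j) ` L_sub q 1 i \<subseteq> P b" using b(2) by (metis image_subsetI)
  then show "\<exists>b\<in>S. (F_rot q \<pi> ^^ j) ` L_sub q 1 i \<subseteq> P b" using b(1) by blast
qed

text \<open>For odd \<open>q\<close> the word is an itinerary under \<open>F_rot\<close> by
  definition. For even \<open>q\<close> it comes from \<open>chi_seq\<close> at k = 1, hence from
  the first return to \<open>L q 0\<close> = [0,1), which coincides with \<open>F_rot\<close>
  there.\<close>

lemma psi_word_chi:
  assumes q: "0 < q" and \<pi>: "\<pi> permutes {..<q}" and a: "a \<in> alphabet q"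
    and x: "x \<in> L_sub q 1 (letter_index q a)"
  shows "psi_word q (chi q \<pi> a)
    = (\<Sum>j<return_time (F_rot q \<pi>) (L q 1) x. psi_skew ((F_rot q \<pi> ^^ j) x))"
proof (cases "even q")
  case False
  then have "psi_word q (chi q \<pi> a) = (\<Sum>b\<leftarrow>itinerary (F_rot q \<pi>) (alphabet q)
      (letter_interval q) (L q 1) (L_sub q 1 (letter_index q a)). psi_letter q b)"
    by (simp add: psi_word_def chi_def)
  also have "\<dots> = (\<Sum>j<return_time (F_rot q \<pi>) (L q 1) x. psi_skew ((F_rot q \<pi> ^^ j) x))"
    by (rule sum_list_itinerary_F_rot[OF q \<pi> letter_index_less[OF q a] x
          letter_interval_cell[OF q] letter_interval_unique[OF q] psi_letter_eq[OF q]])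
  finally show ?thesis .
next
  case True
  let ?J = "L_sub q 1 (letter_index q a)"
  have "?J \<subseteq> {0..<1}" using L_sub_1_subset[OF q letter_index_less[OF q a]] L_1_subset by blast
  then have "chi_seq q \<pi> 1 (letter_index q a)
      = itinerary (F_rot q \<pi>) {..<q} (L_sub q 0) (L q 1) ?J"
    unfolding chi_seq_def F_ind_def diff_self_eq_0 L_0
    by (intro itinerary_cong[OF first_return_whole_space[OF F_rot_in[OF q \<pi>]] F_rot_in[OF q \<pi>]])
  then have "psi_word q (chi q \<pi> a)
      = (\<Sum>i\<leftarrow>itinerary (F_rot q \<pi>) {..<q} (L_sub q 0) (L q 1) ?J. psi_letter q (Letter i))"
    using True by (simp add: psi_word_def chi_def comp_def)
  also have "\<dots> = (\<Sum>j<return_time (F_rot q \<pi>) (L q 1) x. psi_skew ((F_rot q \<pi> ^^ j) x))"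
  proof (rule sum_list_itinerary_F_rot[OF q \<pi> letter_index_less[OF q a] x
        L_sub_0_cell[OF q] L_sub_0_unique[OF q]])
    show "psi_letter q (Letter i) = psi_skew y" if "i \<in> {..<q}" "y \<in> L_sub q 0 i" for i y
      by (rule psi_letter_eq[OF q]) (use that True in \<open>simp_all add: alphabet_def\<close>)
  qed
  finally show ?thesis .
qed

lemma d_gcd_dvd_return_sum:
  assumes q: "0 < q" and \<pi>: "\<pi> permutes {..<q}" and x: "x \<in> L q 1"
  shows "d_gcd q \<pi> dvd (\<Sum>j<return_time (F_rot q \<pi>) (L q 1) x. psi_skew ((F_rot q \<pi> ^^ j) x))"
proof -
  obtain i where i: "i < q" "x \<in> L_sub q 1 i" using L_1_subset_cells[OF q x] .
  obtain a where a: "a \<in> alphabet q" "letter_index q a = i" using letter_index_surj[OF i(1)] .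
  have "x \<in> L_sub q 1 (letter_index q a)" using i(2) a(2) by simp
  from psi_word_chi[OF q \<pi> a(1) this] show ?thesis
    unfolding d_gcd_def using a(1) by (metis Gcd_dvd imageI)
qed

section \<open>The invariant set\<close>

text \<open>Needed for measurability: the invariant set is then described by integers alone, the
  cell index and the second coordinate.\<close>

lemma hit_sum_cell:
  assumes q: "0 < q" and \<pi>: "\<pi> permutes {..<q}"
  shows "hit_sum (F_rot q \<pi>) (L q 1) psi_skew x s \<Longrightarrow> x \<in> {0..<1} \<Longrightarrow> y \<in> {0..<1} \<Longrightarrow>
    cell_index q x = cell_index q y \<Longrightarrow> hit_sum (F_rot q \<pi>) (L q 1) psi_skew y s"
proof (induction arbitrary: y rule: hit_sum.induct)
  case (hit_now x)
  then have "y \<in> L q 1" using L_1_cell[OF q hit_now.prems(3)] by simp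
  then show ?case by (rule hit_sum.hit_now)
next
  case (hit_later x s)
  let ?F = "F_rot q \<pi>"
  have y: "y \<notin> L q 1" using L_1_cell[OF q hit_later.prems(3)] hit_later.prems hit_later.hyps by simp
  have in01: "?F x \<in> {0..<1}" "?F y \<in> {0..<1}" using F_rot_in[OF q \<pi>] hit_later.prems by blast+
  have "hit_sum ?F (L q 1) psi_skew (?F y) s"
  proof (cases "?F x \<in> L q 1")
    case True
    then have "?F y \<in> L q 1" using F_rot_L_1_cell[OF q \<pi> hit_later.prems] by simp
    then show ?thesis using hit_later.hyps(2) True by (simp add: hit_sum_in)
  next
    case False
    show ?thesis
      by (rule hit_later.IH[OF in01 F_rot_same_cell[OF q \<pi> hit_later.prems False]])
  qed
  with y show ?case
    unfolding psi_skew_cell[OF q hit_later.prems(3)] by (rule hit_sum.hit_later)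
qed

text \<open>The condition n + h(x) \<equiv> 0 modulo \<open>d\<close>, with h the hitting sum.
  Points that never reach \<open>L q 1\<close> have no h and are left out; off \<open>L q 1\<close>,
  x has a hitting sum exactly if its image has one.\<close>

definition invariant_set :: "nat \<Rightarrow> (nat \<Rightarrow> nat) \<Rightarrow> int \<Rightarrow> (real \<times> int) set" where
  "invariant_set q \<pi> d = {(x, n). x \<in> {0..<1} \<and>
     (\<exists>s. hit_sum (F_rot q \<pi>) (L q 1) psi_skew x s \<and> d dvd n + s)}"

text \<open>Off \<open>L q 1\<close> the value n + h(x) is preserved exactly. On
  \<open>L q 1\<close> it changes by the sum of \<open>psi_skew\<close> over the return, which is a
  multiple of \<open>d_gcd q \<pi>\<close>.\<close>

lemma invariant_set_invariant:
  assumes q: "0 < q" and \<pi>: "\<pi> permutes {..<q}" and x: "x \<in> {0..<1}"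
  shows "T_skew q \<pi> (x, n) \<in> invariant_set q \<pi> (d_gcd q \<pi>)
    \<longleftrightarrow> (x, n) \<in> invariant_set q \<pi> (d_gcd q \<pi>)"
proof -
  let ?h = "hit_sum (F_rot q \<pi>) (L q 1) psi_skew" and ?d = "d_gcd q \<pi>"
  have "(\<exists>s. ?h (F_rot q \<pi> x) s \<and> ?d dvd n + psi_skew x + s) \<longleftrightarrow> (\<exists>s. ?h x s \<and> ?d dvd n + s)"
  proof (cases "x \<in> L q 1")
    case False
    have "(\<exists>s. ?h x s \<and> ?d dvd n + s)
        \<longleftrightarrow> (\<exists>s. ?h (F_rot q \<pi> x) (s - psi_skew x) \<and> ?d dvd n + s)"
      using hit_sum_notin[OF False] by simp
    also have "\<dots> \<longleftrightarrow> (\<exists>s. ?h (F_rot q \<pi> x) s \<and> ?d dvd n + psi_skew x + s)"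
    proof
      assume "\<exists>s. ?h (F_rot q \<pi> x) (s - psi_skew x) \<and> ?d dvd n + s"
      then obtain s where "?h (F_rot q \<pi> x) (s - psi_skew x)" "?d dvd n + s" by blast
      then show "\<exists>s. ?h (F_rot q \<pi> x) s \<and> ?d dvd n + psi_skew x + s"
        by (intro exI[of _ "s - psi_skew x"]) simp
    next
      assume "\<exists>s. ?h (F_rot q \<pi> x) s \<and> ?d dvd n + psi_skew x + s"
      then obtain s where "?h (F_rot q \<pi> x) s" "?d dvd n + psi_skew x + s" by blast
      then show "\<exists>s. ?h (F_rot q \<pi> x) (s - psi_skew x) \<and> ?d dvd n + s"
        by (intro exI[of _ "s + psi_skew x"]) (simp add: ac_simps)
    qed
    finally show ?thesis by blast
  next
    case True
    define \<Sigma> where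
      "\<Sigma> = (\<Sum>j<return_time (F_rot q \<pi>) (L q 1) x. psi_skew ((F_rot q \<pi> ^^ j) x))"
    have "?h (F_rot q \<pi> x) (\<Sigma> - psi_skew x)"
      unfolding \<Sigma>_def by (rule hit_sum_return[OF L_1_returns[OF q \<pi> True]])
    \<comment> \<open>Uniqueness of hitting sums lets the quantified s be replaced by the one known
      value.\<close>
    then have "(\<exists>s. ?h (F_rot q \<pi> x) s \<and> ?d dvd n + psi_skew x + s)
        \<longleftrightarrow> ?d dvd n + psi_skew x + (\<Sigma> - psi_skew x)"
      using hit_sum_unique by metis
    also have "\<dots> \<longleftrightarrow> ?d dvd n + \<Sigma>" by simp
    also have "\<dots> \<longleftrightarrow> ?d dvd n"
      using d_gcd_dvd_return_sum[OF q \<pi> True] unfolding \<Sigma>_def by (rule dvd_add_left_iff)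
    also have "\<dots> \<longleftrightarrow> (\<exists>s. ?h x s \<and> ?d dvd n + s)" using True by (simp add: hit_sum_in)
    finally show ?thesis .
  qed
  moreover have "F_rot q \<pi> x \<in> {0..<1}" using F_rot_in[OF q \<pi>] x by blast
  ultimately show ?thesis using x by (simp add: T_skew_def invariant_set_def)
qed

section \<open>Measurability and positive measure\<close>

lemma cell_in_sets_Leb: "{x \<in> {0..<1}. cell_index q x = k} \<in> sets Leb"
proof -
  have "{x. cell_index q x = k} = {x. \<lfloor>real (grid q) * x\<rfloor> = k}" by (simp add: cell_index_def)
  also have "\<dots> \<in> sets lborel" by measurable
  finally have "{0..<1} \<inter> {x. cell_index q x = k} \<in> sets Leb"
    unfolding Leb_def sets_restrict_space by blast
  then show ?thesis by (simp add: Int_def)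
qed

lemma invariant_set_measurable:
  assumes q: "0 < q" and \<pi>: "\<pi> permutes {..<q}"
  shows "invariant_set q \<pi> d \<in> sets (Leb \<Otimes>\<^sub>M (count_space UNIV :: int measure))"
proof -
  let ?C = "\<lambda>k. {x \<in> {0..<1}. cell_index q x = k}" and ?A = "invariant_set q \<pi> d"
  \<comment> \<open>A set of pairs of integers, so the union over it is countable.\<close>
  let ?K = "{(k, n). \<exists>x. (x, n) \<in> ?A \<and> cell_index q x = k}"
  have "(y, n) \<in> ?A" if "(x, n) \<in> ?A" "y \<in> {0..<1}" "cell_index q x = cell_index q y" for x y n
    using that hit_sum_cell[OF q \<pi> _ _ that(2,3)] unfolding invariant_set_def by auto
  moreover have "?A \<subseteq> {0..<1} \<times> UNIV" by (auto simp: invariant_set_def)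
  ultimately have "?A = (\<Union>(k, n)\<in>?K. ?C k \<times> {n})" by fastforce
  also have "\<dots> \<in> sets (Leb \<Otimes>\<^sub>M (count_space UNIV :: int measure))"
  proof (rule sets.countable_UN'')
    show "(case p of (k, n) \<Rightarrow> ?C k \<times> {n}) \<in> sets (Leb \<Otimes>\<^sub>M (count_space UNIV :: int measure))"
      for p
      unfolding split_beta by (rule pair_measureI[OF cell_in_sets_Leb]) simp
  qed simp
  finally show ?thesis .
qed

text \<open>Such a slice has measure 2^-N > 0. It will be applied both to the invariant set and to
  its complement, with different \<open>n\<close>.\<close>

lemma L_1_times_not_null:
  assumes "L q 1 \<times> {n} \<subseteq> X"
  shows "X \<notin> null_sets (Leb \<Otimes>\<^sub>M (count_space UNIV :: int measure))"
proof
  assume X: "X \<in> null_sets (Leb \<Otimes>\<^sub>M (count_space UNIV :: int measure))"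
  interpret sigma_finite_measure "count_space UNIV :: int measure"
    by (rule sigma_finite_measure_count_space_countable) simp
  have L: "L q 1 \<in> sets Leb"
    unfolding Leb_def using L_1_subset[of q] unfolding L_1 by (simp add: sets_restrict_space_iff)
  have "emeasure Leb (L q 1) = emeasure lborel (L q 1)"
    unfolding Leb_def using L_1_subset by (intro emeasure_restrict_space) auto
  also have "\<dots> = ennreal (1 / 2 ^ N_exp q)" unfolding L_1 by simp
  finally have "emeasure (Leb \<Otimes>\<^sub>M (count_space UNIV :: int measure)) (L q 1 \<times> {n})
      = ennreal (1 / 2 ^ N_exp q)"
    using emeasure_pair_measure_Times[OF L, of "{n}"] by simp
  moreover have "L q 1 \<times> {n} \<in> null_sets (Leb \<Otimes>\<^sub>M (count_space UNIV :: int measure))"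
    using X assms L by (elim null_sets_subset) auto
  ultimately show False by (simp add: null_sets_def)
qed

theorem theorem1p9:
  fixes q :: nat and \<pi> :: "nat \<Rightarrow> nat"
  assumes "0 < q"
    and "\<not> (\<exists>k::nat. q = 2 ^ k)"
    and "\<pi> permutes {..<q}"
    and "stationary q \<pi>"
    and "ergodic Leb (F_rot q \<pi>)"
    and "2 \<le> d_gcd q \<pi>"
  shows "\<not> ergodic (Leb \<Otimes>\<^sub>M (count_space UNIV :: int measure)) (T_skew q \<pi>)"
proof
  let ?M = "Leb \<Otimes>\<^sub>M (count_space UNIV :: int measure)"
  let ?A = "invariant_set q \<pi> (d_gcd q \<pi>)"
  assume erg: "ergodic ?M (T_skew q \<pi>)"
  have space: "space ?M = {0..<1} \<times> UNIV"
    by (simp add: space_pair_measure Leb_def space_restrict_space)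
  have "?A \<subseteq> space ?M" unfolding space by (auto simp: invariant_set_def)
  then have "T_skew q \<pi> -` ?A \<inter> space ?M = ?A"
    unfolding space using invariant_set_invariant[OF assms(1,3)] by blast
  then have "?A \<in> null_sets ?M \<or> space ?M - ?A \<in> null_sets ?M"
    using erg invariant_set_measurable[OF assms(1,3)] unfolding ergodic_def by blast
  \<comment> \<open>Over \<open>L q 1\<close> the hitting sum is 0, so the fibre consists of the
    multiples of d: level 0 belongs to the set.\<close>
  moreover have A_iff: "(x, n) \<in> ?A \<longleftrightarrow> d_gcd q \<pi> dvd n" if "x \<in> L q 1" for x n
    using that L_1_subset[of q] unfolding invariant_set_def mem_Collect_eq case_prod_conv
      hit_sum_in[OF that] by auto
  then have "L q 1 \<times> {0} \<subseteq> ?A" by auto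
  \<comment> \<open>Here d \<ge> 2 enters: it puts level 1 over \<open>L q 1\<close> into the
    complement.\<close>
  moreover have "\<not> d_gcd q \<pi> dvd 1" using assms(6) zdvd_imp_le[of "d_gcd q \<pi>" 1] by auto
  then have "L q 1 \<times> {1} \<subseteq> space ?M - ?A"
    unfolding space using L_1_subset[of q] A_iff by auto
  ultimately show False using L_1_times_not_null by blast
qed

end
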